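(* The ladder graph $L_n$ is $3$-EKR for all $n\geq 1$.
   Context: The ladder graph $L_n$ with $n$ rungs is the Cartesian product of $K_2$ and the path $P_n$ on $n$ vertices: its vertices are $x_1,\ldots,x_n,y_1,\ldots,y_n$ and its edges are $x_iy_i$ ($1\leq i\leq n$, the rungs), $x_ix_{i+1}$ and $y_iy_{i+1}$ ($1\leq i\leq n-1$). For a graph $G$ and an integer $r\geq 1$, $\mathcal{J}^{(r)}(G)$ is the family of all independent sets of $G$ of size $r$; for $v\in V(G)$, the star centered at $v$ is $\mathcal{J}_v^{(r)}(G)=\{A\in\mathcal{J}^{(r)}(G): v\in A\}$. A family $\mathcal{A}$ of sets is intersecting if $A\cap B\neq\emptyset$ for all $A,B\in\mathcal{A}$. $G$ is $r$-EKR if no intersecting subfamily of $\mathcal{J}^{(r)}(G)$ is larger than the largest star in $\mathcal{J}^{(r)}(G)$ (this holds vacuously if $\mathcal{J}^{(r)}(G)=\emptyset$). *)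

theory Defs
  imports "Graph_Theory.Pair_Digraph"
begin

text \<open>
  A finite simple graph is a \<^locale>\<open>pair_graph\<close>: a loop-free digraph with a symmetric arc set,
  each undirected edge being represented by its two orientations.
\<close>

datatype ladder_vertex = X nat | Y nat

definition ladder_edges :: "nat \<Rightarrow> (ladder_vertex \<times> ladder_vertex) set" where
  "ladder_edges n =
     {(X i, Y i) | i. 1 \<le> i \<and> i \<le> n} \<union>
     {(X i, X (i + 1)) | i. 1 \<le> i \<and> i + 1 \<le> n} \<union>
     {(Y i, Y (i + 1)) | i. 1 \<le> i \<and> i + 1 \<le> n}"

definition ladder :: "nat \<Rightarrow> ladder_vertex pair_pre_digraph" where
  "ladder n = \<lparr>pverts = X ` {1..n} \<union> Y ` {1..n}, parcs = ladder_edges n \<union> (ladder_edges n)\<inverse>\<rparr>"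

lemma pair_graph_ladder: "pair_graph (ladder n)"
proof -
  let ?V = "X ` {1..n} \<union> Y ` {1..n}"
  have "parcs (ladder n) \<subseteq> ?V \<times> ?V"
    by (auto simp: ladder_def ladder_edges_def)
  then have fin: "finite (parcs (ladder n))"
    by (rule finite_subset) simp
  show ?thesis
  proof
    show "finite (parcs (ladder n))" by (fact fin)
    show "symmetric (with_proj (ladder n))"
      by (auto simp: symmetric_def sym_def arcs_ends_def arc_to_ends_def ladder_def)
  qed (auto simp: ladder_def ladder_edges_def)
qed

definition indep_sets :: "'a pair_pre_digraph \<Rightarrow> nat \<Rightarrow> 'a set set" where
  "indep_sets G r =
     {A. A \<subseteq> pverts G \<and> card A = r \<and> (\<forall>u\<in>A. \<forall>v\<in>A. (u, v) \<notin> parcs G)}"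

definition star :: "'a pair_pre_digraph \<Rightarrow> nat \<Rightarrow> 'a \<Rightarrow> 'a set set" where
  "star G r v = {A \<in> indep_sets G r. v \<in> A}"

definition intersecting :: "'a set set \<Rightarrow> bool" where
  "intersecting F \<longleftrightarrow> (\<forall>A\<in>F. \<forall>B\<in>F. A \<inter> B \<noteq> {})"

text \<open>
  Meant for finite \<open>G\<close> and \<open>r \<ge> 1\<close>: \<^const>\<open>Max\<close> is meaningful only on a finite nonempty set. If
  \<open>G\<close> has no vertices, or more generally if \<open>indep_sets G r\<close> is empty, then the only candidate
  for \<open>F\<close> is the empty family, and the condition holds vacuously.
\<close>

definition EKR :: "nat \<Rightarrow> 'a pair_pre_digraph \<Rightarrow> bool" where
  "EKR r G \<longleftrightarrow>
     \<not> (\<exists>F \<subseteq> indep_sets G r. intersecting F \<and> card F > Max {card (star G r v) | v. v \<in> pverts G})"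

end

theory Submission
  imports Defs
begin

text \<open>
  Vertices in the same column of the ladder are adjacent, so an independent triple occupies three
  different columns. Counting by the last column shows that for \<open>n \<ge> 3\<close> the star at the
  corner \<open>X 1\<close> has at least \<open>1 + 2 (n - 2) (n - 3)\<close> members (\<open>card_star_corner_ge\<close>).
  An intersecting family with a common vertex lies in a star, so it remains to see that an
  intersecting family without a common vertex is not larger than this number.

  For \<open>n \<ge> 6\<close> this is a Hilton--Milner type estimate. Two vertices are contained in at most
  \<open>D = 2 n - 5\<close> independent triples, because they exclude the four vertices of their columns and
  at least one further neighbour (\<open>card_indep_containing_pair_le\<close>). In an intersecting triple
  system without a common element, a pair that fails to meet some member \<open>B\<close> has codegree at most
  3, the third element being forced into \<open>B\<close>. Distinguishing which pairs meet all members gives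
  at most \<open>max 25 (3 D + 3)\<close> members (\<open>nontrivial_triple_system.card_le\<close>). This is at most
  \<open>1 + 2 (n - 2) (n - 3)\<close> from \<open>n = 6\<close> on, where both sides are 25.

  For \<open>n \<le> 5\<close> that estimate is too weak. Instead, the independent triples are partitioned into
  cycles of the Kneser graph, that is, cyclic lists in which neighbours are disjoint. An
  intersecting family contains at most \<open>length As div 2\<close> entries of such a list \<open>As\<close>, and the
  partitions \<open>kneser_cycles n\<close> are chosen so that these bounds add up to the size of the corner
  star.
\<close>

section \<open>Cycles in the Kneser graph of pairwise disjoint sets\<close>

text \<open>
  Only cyclically consecutive sets are required to be disjoint. A list of length 2 is a disjoint
  pair, and a list of length 3 consists of pairwise disjoint sets.
\<close>

definition disjoint_cycle :: "'a set list \<Rightarrow> bool" where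
  "disjoint_cycle As \<longleftrightarrow> list_all2 (\<lambda>A B. A \<inter> B = {}) As (rotate1 As)"

lemma card_Int_set_le_sum_list: "card (F \<inter> set As) \<le> (\<Sum>A\<leftarrow>As. of_bool (A \<in> F))"
proof (induction As)
  case Nil
  then show ?case by simp
next
  case (Cons A As)
  have "card (F \<inter> set (A # As)) \<le> of_bool (A \<in> F) + card (F \<inter> set As)"
    by (cases "A \<in> F") (simp_all add: Int_insert_right card_insert_if)
  with Cons show ?case by simp
qed

text \<open>
  Of two consecutive sets at most one belongs to \<open>F\<close>; summing over all consecutive pairs counts
  every entry twice. Integrality then rounds down, which is why odd cycles give more than
  disjoint pairs do.
\<close>

lemma card_Int_disjoint_cycle_le:
  assumes F: "intersecting F" and cyc: "disjoint_cycle As"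
  shows "card (F \<inter> set As) \<le> length As div 2"
proof -
  let ?f = "\<lambda>A. of_bool (A \<in> F) :: nat"
  have "(\<Sum>A\<leftarrow>As. ?f A) + (\<Sum>A\<leftarrow>Bs. ?f A) \<le> length As"
    if "list_all2 (\<lambda>A B. A \<inter> B = {}) As Bs" for As Bs
    using that
  proof induction
    case (Cons A As B Bs)
    then have "?f A + ?f B \<le> 1"
      using F by (auto simp: intersecting_def)
    with Cons show ?case by simp
  qed simp
  from this[OF cyc[unfolded disjoint_cycle_def]]
  have "(\<Sum>A\<leftarrow>As. ?f A) + (\<Sum>A\<leftarrow>rotate1 As. ?f A) \<le> length As" .
  moreover have "(\<Sum>A\<leftarrow>rotate1 As. ?f A) = (\<Sum>A\<leftarrow>As. ?f A)"
    by (cases As) simp_all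
  ultimately show ?thesis
    using card_Int_set_le_sum_list[of F As] by linarith
qed

lemma intersecting_card_le_cycle_cover:
  assumes F: "intersecting F" and cov: "F \<subseteq> (\<Union>As\<in>set Cs. set As)"
    and cyc: "list_all disjoint_cycle Cs"
  shows "card F \<le> (\<Sum>As\<leftarrow>Cs. length As div 2)"
proof -
  have "card (F \<inter> (\<Union>As\<in>set Cs. set As)) \<le> (\<Sum>As\<leftarrow>Cs. length As div 2)"
    using cyc
  proof (induction Cs)
    case (Cons As Cs)
    have "card (F \<inter> (\<Union>As\<in>set (As # Cs). set As))
        \<le> card (F \<inter> set As) + card (F \<inter> (\<Union>As\<in>set Cs. set As))"
      using card_Un_le[of "F \<inter> set As"] by (simp add: Int_Un_distrib)
    also have "\<dots> \<le> length As div 2 + (\<Sum>As\<leftarrow>Cs. length As div 2)"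
      using Cons card_Int_disjoint_cycle_le[OF F, of As] by (intro add_mono) auto
    finally show ?case by simp
  qed simp
  with cov show ?thesis by (simp add: Int_absorb2)
qed

section \<open>Intersecting triple systems without a common element\<close>

lemma card_3_eq_insert:
  assumes "card A = 3" "u \<in> A" "w \<in> A" "z \<in> A" "u \<noteq> w" "u \<noteq> z" "w \<noteq> z"
  shows "A = {u, w, z}"
proof -
  have "finite A" using assms(1) by (metis card.infinite zero_neq_numeral)
  then show ?thesis
    using card_subset_eq[of A "{u, w, z}"] assms by simp
qed

locale nontrivial_triple_system =
  fixes F :: "'a set set" and D :: nat
  assumes finite_F: "finite F" and intersecting_F: "intersecting F"
    and card_3: "A \<in> F \<Longrightarrow> card A = 3"
    and no_common: "\<exists>A\<in>F. v \<notin> A"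
    and codegree: "u \<noteq> w \<Longrightarrow> card {A \<in> F. u \<in> A \<and> w \<in> A} \<le> D"
begin

definition link :: "'a \<Rightarrow> 'a \<Rightarrow> 'a set set" where
  "link u w = {A \<in> F. u \<in> A \<and> w \<in> A}"

definition cover :: "'a \<Rightarrow> 'a \<Rightarrow> bool" where
  "cover u w \<longleftrightarrow> (\<forall>A\<in>F. u \<in> A \<or> w \<in> A)"

lemma finite_link [simp]: "finite (link u w)"
  using finite_F by (simp add: link_def)

lemma card_link_le: "u \<noteq> w \<Longrightarrow> card (link u w) \<le> D"
  unfolding link_def by (rule codegree)

lemma finite_member: "A \<in> F \<Longrightarrow> finite A"
  using card_3 by (metis card.infinite zero_neq_numeral)

lemma meet: "A \<in> F \<Longrightarrow> B \<in> F \<Longrightarrow> A \<inter> B \<noteq> {}"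
  using intersecting_F by (auto simp: intersecting_def)

text \<open>
  A member containing \<open>u\<close> and \<open>w\<close> is determined by its third element, which has to lie in any
  member that avoids both.
\<close>

lemma card_link_le_3:
  assumes "\<not> cover u w" "u \<noteq> w"
  shows "card (link u w) \<le> 3"
proof -
  obtain B where B: "B \<in> F" "u \<notin> B" "w \<notin> B"
    using assms(1) by (auto simp: cover_def)
  have "link u w \<subseteq> (\<lambda>z. {u, w, z}) ` B"
  proof
    fix A assume A: "A \<in> link u w"
    then obtain z where "z \<in> A" "z \<in> B"
      using meet[of A B] B by (auto simp: link_def)
    with A B \<open>u \<noteq> w\<close> have "A = {u, w, z}"
      by (intro card_3_eq_insert) (auto simp: link_def card_3)
    with \<open>z \<in> B\<close> show "A \<in> (\<lambda>z. {u, w, z}) ` B" by blast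
  qed
  then have "card (link u w) \<le> card B"
    using B finite_member by (meson card_image_le card_mono finite_imageI le_trans)
  with B card_3 show ?thesis by simp
qed

text \<open>
  Every codegree is at most 3, hence every degree at most 9. Counting the members through the
  elements of a fixed member \<open>A\<close> gives 27, in which \<open>A\<close> itself is counted three times.
\<close>

lemma card_le_25_if_no_cover:
  assumes nc: "\<And>u w. u \<noteq> w \<Longrightarrow> \<not> cover u w"
  shows "card F \<le> 25"
proof -
  have degree: "card {A \<in> F. v \<in> A} \<le> 9" for v
  proof -
    obtain B where B: "B \<in> F" "v \<notin> B" using no_common by blast
    have "{A \<in> F. v \<in> A} \<subseteq> (\<Union>b\<in>B. link v b)"
      using meet B by (fastforce simp: link_def)
    then have "card {A \<in> F. v \<in> A} \<le> card (\<Union>b\<in>B. link v b)"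
      using B finite_member by (intro card_mono) auto
    also have "\<dots> \<le> (\<Sum>b\<in>B. card (link v b))"
      using B finite_member by (intro card_UN_le) auto
    also have "\<dots> \<le> (\<Sum>b\<in>B. 3)"
      using B nc by (intro sum_mono card_link_le_3) metis+
    finally show ?thesis using B card_3 by simp
  qed
  obtain A where A: "A \<in> F" using no_common by blast
  have "card ({B \<in> F. a \<in> B} - {A}) \<le> 8" if "a \<in> A" for a
    using degree[of a] A that finite_F by simp
  then have "(\<Sum>a\<in>A. card ({B \<in> F. a \<in> B} - {A})) \<le> (\<Sum>a\<in>A. 8)"
    by (intro sum_mono)
  then have sum: "(\<Sum>a\<in>A. card ({B \<in> F. a \<in> B} - {A})) \<le> 24"
    using A card_3 by simp
  have "F \<subseteq> insert A (\<Union>a\<in>A. {B \<in> F. a \<in> B} - {A})"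
    using meet A by fastforce
  then have "card F \<le> card (insert A (\<Union>a\<in>A. {B \<in> F. a \<in> B} - {A}))"
    using A finite_member finite_F by (intro card_mono) auto
  also have "\<dots> \<le> Suc (card (\<Union>a\<in>A. {B \<in> F. a \<in> B} - {A}))"
    by (rule card_insert_le_m1) simp_all
  also have "\<dots> \<le> Suc (\<Sum>a\<in>A. card ({B \<in> F. a \<in> B} - {A}))"
    using card_UN_le[OF finite_member[OF A], of "\<lambda>a. {B \<in> F. a \<in> B} - {A}"] by simp
  finally show ?thesis using sum by simp
qed

lemma card_le_link_plus_avoiding:
  "card F \<le> card (link u w) + card {A \<in> F. w \<notin> A} + card {A \<in> F. u \<notin> A}"
proof -
  let ?U = "{A \<in> F. w \<notin> A}" and ?W = "{A \<in> F. u \<notin> A}"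
  have "F = link u w \<union> ?U \<union> ?W"
    by (auto simp: link_def)
  then have "card F = card (link u w \<union> ?U \<union> ?W)" by (rule arg_cong)
  also have "\<dots> \<le> card (link u w) + card ?U + card ?W"
    using card_Un_le[of "link u w \<union> ?U" ?W] card_Un_le[of "link u w" ?U] by linarith
  finally show ?thesis .
qed

text \<open>
  Fix a member \<open>B = {w, p, q}\<close> avoiding \<open>u\<close>. The members avoiding \<open>w\<close> contain \<open>u\<close>, and meet
  \<open>B\<close> in \<open>p\<close> or \<open>q\<close>. If neither \<open>{u, p}\<close> nor \<open>{u, q}\<close> is a cover, there are at most
  \<open>3 + 3\<close> of them. If \<open>{u, p}\<close> is a cover, all members avoiding \<open>u\<close> contain both \<open>w\<close> and \<open>p\<close>,
  so there are at most \<open>D\<close>; and if \<open>{u, q}\<close> is a cover as well, \<open>B\<close> is the only one.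
\<close>

lemma cover_dichotomy:
  assumes cov: "cover u w" and "u \<noteq> w"
  shows "card {A \<in> F. w \<notin> A} \<le> 6 \<or> card F \<le> 3 * D + 3"
proof -
  let ?U = "{A \<in> F. w \<notin> A}" and ?W = "{A \<in> F. u \<notin> A}"
  obtain B where B: "B \<in> F" "u \<notin> B" using no_common by blast
  then have "w \<in> B" using cov by (auto simp: cover_def)
  have "card (B - {w}) = 2"
    using B card_3 \<open>w \<in> B\<close> finite_member by simp
  then obtain p q where pq: "B - {w} = {p, q}" "p \<noteq> q"
    by (auto simp: card_2_iff)
  then have B_eq: "B = {w, p, q}" and ne: "p \<noteq> w" "q \<noteq> w" "u \<noteq> p" "u \<noteq> q"
    using \<open>w \<in> B\<close> B by auto
  have "?U \<subseteq> link u p \<union> link u q"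
  proof
    fix A assume A: "A \<in> ?U"
    then have "u \<in> A" using cov by (auto simp: cover_def)
    moreover have "p \<in> A \<or> q \<in> A" using meet[of A B] A B B_eq by auto
    ultimately show "A \<in> link u p \<union> link u q" using A by (auto simp: link_def)
  qed
  then have U: "card ?U \<le> card (link u p) + card (link u q)"
    by (meson card_Un_le card_mono finite_UnI finite_link le_trans)
  have L: "card (link u w) \<le> D" "card (link u p) \<le> D" "card (link u q) \<le> D"
    using card_link_le \<open>u \<noteq> w\<close> ne by auto
  have W: "card ?W \<le> D" if "cover u z" "z \<noteq> w" for z
  proof -
    have "?W \<subseteq> link w z" using cov that by (auto simp: cover_def link_def)
    then have "card ?W \<le> card (link w z)" by (intro card_mono) simp_all
    also have "\<dots> \<le> D" using that card_link_le by auto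
    finally show ?thesis .
  qed
  note split = card_le_link_plus_avoiding[of u w]
  consider "cover u p" "cover u q" | "cover u p" "\<not> cover u q"
    | "\<not> cover u p" "cover u q" | "\<not> cover u p" "\<not> cover u q" by blast
  then show ?thesis
  proof cases
    case 1
    have "?W \<subseteq> {B}"
    proof
      fix A assume "A \<in> ?W"
      then have "A = {w, p, q}"
        using 1 cov ne pq by (intro card_3_eq_insert) (auto simp: cover_def card_3)
      then show "A \<in> {B}" by (simp add: B_eq)
    qed
    then have "card ?W \<le> card {B}" by (intro card_mono) simp_all
    then show ?thesis using U L split by simp
  next
    case 2
    then show ?thesis using U L split W[of p] ne card_link_le_3[of u q] by simp
  next
    case 3
    then show ?thesis using U L split W[of q] ne card_link_le_3[of u p] by simp
  next
    case 4
    then show ?thesis using U ne card_link_le_3[of u p] card_link_le_3[of u q] by simp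
  qed
qed

text \<open>
  If \<open>{u, w}\<close> is a cover, the dichotomy applies to \<open>(u, w)\<close> and to \<open>(w, u)\<close>. When the bound
  \<open>3 * D + 3\<close> comes out of neither, there are at most \<open>D + 6 + 6\<close> members; this exceeds 25 only
  if \<open>D > 13\<close>, when it is below \<open>3 * D + 3\<close>.
\<close>

theorem card_le: "card F \<le> max 25 (3 * D + 3)"
proof (cases "\<exists>u w. u \<noteq> w \<and> cover u w")
  case True
  then obtain u w where uw: "u \<noteq> w" "cover u w" by blast
  then have wu: "cover w u" by (simp add: cover_def disj_commute)
  have "card F \<le> D + 12 \<or> card F \<le> 3 * D + 3"
    using cover_dichotomy[OF uw(2,1)] cover_dichotomy[OF wu uw(1)[symmetric]]
      card_le_link_plus_avoiding[of u w] card_link_le[OF uw(1)] by linarith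
  then show ?thesis by linarith
next
  case False
  then have "card F \<le> 25" by (intro card_le_25_if_no_cover) blast
  then show ?thesis by simp
qed

end

section \<open>Independent sets of a ladder\<close>

fun column :: "ladder_vertex \<Rightarrow> nat" where
  "column (X i) = i"
| "column (Y i) = i"

lemma pverts_ladder: "v \<in> pverts (ladder n) \<longleftrightarrow> 1 \<le> column v \<and> column v \<le> n"
  by (cases v) (auto simp: ladder_def)

lemma finite_pverts_ladder: "finite (pverts (ladder n))"
  by (simp add: ladder_def)

lemma card_pverts_ladder: "card (pverts (ladder n)) = 2 * n"
proof -
  have "card (X ` {1..n} \<union> Y ` {1..n}) = card (X ` {1..n}) + card (Y ` {1..n})"
    by (rule card_Un_disjoint) auto
  then show ?thesis by (simp add: ladder_def card_image inj_on_def)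
qed

lemma finite_indep_sets_ladder: "finite (indep_sets (ladder n) r)"
  by (rule finite_subset[of _ "Pow (pverts (ladder n))"])
    (auto simp: indep_sets_def finite_pverts_ladder)

lemma finite_star: "finite (star (ladder n) r v)"
  by (simp add: star_def finite_indep_sets_ladder)

lemma parcs_ladder [simp]:
  "(X i, X j) \<in> parcs (ladder n) \<longleftrightarrow> {i, j} \<subseteq> {1..n} \<and> (j = i + 1 \<or> i = j + 1)"
  "(Y i, Y j) \<in> parcs (ladder n) \<longleftrightarrow> {i, j} \<subseteq> {1..n} \<and> (j = i + 1 \<or> i = j + 1)"
  "(X i, Y j) \<in> parcs (ladder n) \<longleftrightarrow> i \<in> {1..n} \<and> j = i"
  "(Y i, X j) \<in> parcs (ladder n) \<longleftrightarrow> i \<in> {1..n} \<and> j = i"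
  by (auto simp: ladder_def ladder_edges_def)

lemma inj_on_column:
  assumes "A \<in> indep_sets (ladder n) r"
  shows "inj_on column A"
proof (rule inj_onI)
  fix u v assume uv: "u \<in> A" "v \<in> A" "column u = column v"
  then have "u \<in> pverts (ladder n)" "(u, v) \<notin> parcs (ladder n)"
    using assms by (auto simp: indep_sets_def)
  then show "u = v" using uv by (cases u; cases v) (auto simp: pverts_ladder)
qed

lemma indep_triple_sorted:
  assumes "A \<in> indep_sets (ladder n) 3"
  obtains u v w where "A = {u, v, w}" "1 \<le> column u" "column u < column v"
    "column v < column w" "column w \<le> n"
    "(u, v) \<notin> parcs (ladder n)" "(v, w) \<notin> parcs (ladder n)"
proof -
  note thesis_I = that
  from assms have A: "A \<subseteq> pverts (ladder n)" "card A = 3"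
    "\<forall>u\<in>A. \<forall>v\<in>A. (u, v) \<notin> parcs (ladder n)"
    by (auto simp: indep_sets_def)
  obtain a b c where abc: "A = {a, b, c}" "a \<noteq> b" "a \<noteq> c" "b \<noteq> c"
    using A(2) by (auto simp: card_3_iff)
  then have cols: "column a \<noteq> column b" "column a \<noteq> column c" "column b \<noteq> column c"
    using inj_on_column[OF assms] by (auto simp: inj_on_def)
  have verts: "1 \<le> column v" "column v \<le> n" if "v \<in> A" for v
    using A(1) that pverts_ladder by blast+
  have sorted: thesis if "A = {u, v, w}" "column u < column v" "column v < column w" for u v w
    using that A(3) verts[of u] verts[of w] by (intro thesis_I[of u v w]) auto
  consider "column a < column b" "column b < column c" | "column a < column c" "column c < column b"
    | "column b < column a" "column a < column c" | "column b < column c" "column c < column a"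
    | "column c < column a" "column a < column b" | "column c < column b" "column b < column a"
    using cols by (meson linorder_neqE_nat)
  then show thesis
    using sorted[of a b c] sorted[of a c b] sorted[of b a c] sorted[of b c a] sorted[of c a b]
      sorted[of c b a] abc(1)
    by cases (simp_all add: insert_commute)
qed

text \<open>
  The third vertex avoids both columns of \<open>u\<close> and \<open>w\<close>, which contain four vertices, and also a
  horizontal neighbour of \<open>u\<close> or \<open>w\<close> in some other column. Such a neighbour exists to the left
  of the left vertex, or to the right of the right one, or, if these lie in the first and the
  last column, in column 2.
\<close>

lemma card_indep_containing_pair_le:
  assumes n: "n \<ge> 3" and "u \<noteq> w"
  shows "card {A \<in> indep_sets (ladder n) 3. u \<in> A \<and> w \<in> A} \<le> 2 * n - 5"
    (is "card ?L \<le> _")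
proof (cases "?L = {}")
  case True
  then show ?thesis by (metis card.empty le0)
next
  case False
  let ?G = "ladder n"
  let ?N = "{z \<in> pverts ?G. z \<noteq> u \<and> z \<noteq> w \<and> (u, z) \<notin> parcs ?G \<and> (w, z) \<notin> parcs ?G}"
  have L_sub: "?L \<subseteq> (\<lambda>z. {u, w, z}) ` ?N"
  proof
    fix A assume A: "A \<in> ?L"
    then have "card A = 3" by (simp add: indep_sets_def)
    then have "card (A - {u, w}) \<noteq> 0"
      using A \<open>u \<noteq> w\<close> by (subst card_Diff_subset) auto
    then obtain z where z: "z \<in> A" "z \<noteq> u" "z \<noteq> w"
      by (metis Diff_iff card.empty ex_in_conv insertCI)
    with A \<open>u \<noteq> w\<close> \<open>card A = 3\<close> have "A = {u, w, z}"
      by (intro card_3_eq_insert) auto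
    moreover have "z \<in> ?N" using A z by (auto simp: indep_sets_def)
    ultimately show "A \<in> (\<lambda>z. {u, w, z}) ` ?N" by blast
  qed
  obtain A where A: "A \<in> indep_sets ?G 3" "u \<in> A" "w \<in> A" using False by blast
  then have cols: "column u \<noteq> column w"
    using inj_on_column[of A n 3] \<open>u \<noteq> w\<close> by (auto simp: inj_on_def)
  have uw: "u \<in> pverts ?G" "w \<in> pverts ?G" using A by (auto simp: indep_sets_def)
  have "\<exists>z. z \<in> pverts ?G \<and> ((u, z) \<in> parcs ?G \<or> (w, z) \<in> parcs ?G) \<and>
      column z \<noteq> column u \<and> column z \<noteq> column w"
  proof -
    \<comment> \<open>the vertex of column \<open>i\<close> on the same rail as \<open>v\<close>\<close>
    define shift where "shift v i = (case v of X _ \<Rightarrow> X i | Y _ \<Rightarrow> Y i)" for v and i :: nat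
    have shift [simp]: "column (shift v i) = i" for v i
      by (cases v) (simp_all add: shift_def)
    have arc: "(v, shift v i) \<in> parcs ?G"
      if "v \<in> pverts ?G" "1 \<le> i" "i \<le> n" "i = column v + 1 \<or> column v = i + 1" for v i
      using that by (cases v) (auto simp: shift_def pverts_ladder)
    obtain a b where ab: "{a, b} = {u, w}" "column a < column b"
      using cols by (metis insert_commute linorder_neqE_nat)
    then have abV: "a \<in> pverts ?G" "b \<in> pverts ?G" using uw by (auto simp: doubleton_eq_iff)
    have "\<exists>z. z \<in> pverts ?G \<and> ((a, z) \<in> parcs ?G \<or> (b, z) \<in> parcs ?G) \<and>
        column z \<noteq> column a \<and> column z \<noteq> column b"
    proof -
      consider "column a > 1" | "column b < n" | "column a = 1" "column b = n"
        using abV by (fastforce simp: pverts_ladder)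
      then show ?thesis
      proof cases
        case 1
        then show ?thesis using arc[of a "column a - 1"] abV ab
          by (intro exI[of _ "shift a (column a - 1)"]) (auto simp: pverts_ladder)
      next
        case 2
        then show ?thesis using arc[of b "column b + 1"] abV ab
          by (intro exI[of _ "shift b (column b + 1)"]) (auto simp: pverts_ladder)
      next
        case 3
        then show ?thesis using arc[of a 2] abV n
          by (intro exI[of _ "shift a 2"]) (auto simp: pverts_ladder)
      qed
    qed
    then show ?thesis using ab(1) by (auto simp: doubleton_eq_iff)
  qed
  then obtain z where z: "z \<in> pverts ?G" "(u, z) \<in> parcs ?G \<or> (w, z) \<in> parcs ?G"
    "column z \<noteq> column u" "column z \<noteq> column w" by blast
  let ?i = "column u" and ?j = "column w"
  let ?B = "{X ?i, Y ?i, X ?j, Y ?j, z}"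
  have card_B: "card ?B = 5"
    using cols z by (cases z) auto
  have "?B \<subseteq> pverts ?G" using uw z(1) by (auto simp: pverts_ladder)
  moreover have "v \<notin> ?N" if "v \<in> ?B" for v
    using that z(2) uw by (cases u; cases w) (auto simp: pverts_ladder)
  ultimately have "?N \<subseteq> pverts ?G - ?B" by blast
  then have "card ?N \<le> card (pverts ?G - ?B)"
    using finite_pverts_ladder by (intro card_mono) auto
  also have "\<dots> = card (pverts ?G) - 5"
    using \<open>?B \<subseteq> pverts ?G\<close> card_B by (subst card_Diff_subset) auto
  also have "card (pverts ?G) = 2 * n"
    by (simp add: card_pverts_ladder)
  finally have "card ?N \<le> 2 * n - 5" .
  moreover have "card ?L \<le> card ?N"
    using finite_pverts_ladder by (intro surj_card_le[OF _ L_sub]) simp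
  ultimately show ?thesis by simp
qed

section \<open>The star at a corner\<close>

text \<open>
  The right-hand side is \<open>1\<close> plus the sum of \<open>4 (k - 3)\<close> for \<open>4 \<le> k \<le> n\<close>: for three rungs
  the star is \<open>{{X 1, Y 2, X 3}}\<close>, and \<open>4 (k - 3)\<close> is the number of its triples with last
  column \<open>k\<close>.
\<close>

lemma card_star_corner_ge:
  assumes "n \<ge> 3"
  shows "1 + 2 * (n - 2) * (n - 3) \<le> card (star (ladder n) 3 (X 1))"
  using assms
proof (induction n rule: dec_induct)
  case base
  have "{X 1, Y 2, X 3} \<in> star (ladder 3) 3 (X 1)"
    by (auto simp: star_def indep_sets_def pverts_ladder)
  then have "card (star (ladder 3) 3 (X 1)) \<noteq> 0"
    using finite_star[of 3] by auto
  then show ?case by simp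
next
  case (step n)
  let ?S = "\<lambda>n. star (ladder n) 3 (X 1)"
  let ?x = "X (n + 1)" and ?y = "Y (n + 1)"
  \<comment> \<open>\<open>P\<close> and \<open>Q\<close> contain the possible middle vertices of a triple from \<open>X 1\<close> to \<open>?x\<close> and to
    \<open>?y\<close>. In column 2 only \<open>Y 2\<close> is not adjacent to \<open>X 1\<close>, and in column \<open>n\<close> the neighbour of
    the last vertex is left out.\<close>
  define P where "P = insert (Y 2) (X ` {3..<n} \<union> Y ` {3..n})"
  define Q where "Q = insert (Y 2) (X ` {3..n} \<union> Y ` {3..<n})"
  define T where "T V z = (\<lambda>v. {X 1, v, z}) ` V" for V :: "ladder_vertex set" and z
  have card_columns: "card (insert (Y 2) (X ` I \<union> Y ` J)) = Suc (card I + card J)"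
    if "finite I" "finite J" "2 \<notin> J" for I J :: "nat set"
  proof -
    have "card (X ` I \<union> Y ` J) = card (X ` I) + card (Y ` J)"
      using that by (intro card_Un_disjoint) auto
    also have "\<dots> = card I + card J" by (simp add: card_image inj_on_def)
    finally show ?thesis using that by (subst card_insert_disjoint) auto
  qed
  have card_P: "card P = 2 * n - 4"
    unfolding P_def using step.hyps by (subst card_columns) auto
  have card_Q: "card Q = 2 * n - 4"
    unfolding Q_def using step.hyps by (subst card_columns) auto
  have card_T: "card (T V z) = card V" if "X 1 \<notin> V" "z \<notin> V" for V z
  proof -
    have "inj_on (\<lambda>v. {X 1, v, z}) V"
    proof (rule inj_onI)
      fix v v' assume "v \<in> V" "v' \<in> V" "{X 1, v, z} = {X 1, v', z}"
      then show "v = v'" using that by (metis insertE insertI1 insert_commute singletonD)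
    qed
    then show ?thesis unfolding T_def by (rule card_image)
  qed
  have card_TP: "card (T P ?x) = 2 * n - 4"
    unfolding card_P[symmetric] using step.hyps by (intro card_T) (auto simp: P_def)
  have card_TQ: "card (T Q ?y) = 2 * n - 4"
    unfolding card_Q[symmetric] using step.hyps by (intro card_T) (auto simp: Q_def)
  have fin: "finite (T P ?x)" "finite (T Q ?y)"
    by (auto simp: T_def P_def Q_def)
  have "?S n \<subseteq> ?S (n + 1)"
  proof
    fix A assume A: "A \<in> ?S n"
    have "(u, v) \<notin> parcs (ladder (n + 1))" if "u \<in> A" "v \<in> A" for u v
    proof -
      have "u \<in> pverts (ladder n)" "v \<in> pverts (ladder n)" "(u, v) \<notin> parcs (ladder n)"
        using A that by (auto simp: star_def indep_sets_def)
      then show ?thesis by (cases u; cases v) (auto simp: pverts_ladder)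
    qed
    with A show "A \<in> ?S (n + 1)"
      by (auto simp: star_def indep_sets_def pverts_ladder subset_iff le_SucI)
  qed
  moreover have "T P ?x \<subseteq> ?S (n + 1)" "T Q ?y \<subseteq> ?S (n + 1)"
    using step.hyps
    by (auto simp: T_def P_def Q_def star_def indep_sets_def pverts_ladder)
  ultimately have le: "card (?S n \<union> T P ?x \<union> T Q ?y) \<le> card (?S (n + 1))"
    by (intro card_mono) (auto simp: finite_star)
  have new: "?x \<notin> A \<and> ?y \<notin> A" if "A \<in> ?S n" for A
    using that by (auto simp: star_def indep_sets_def pverts_ladder subset_iff)
  have "?x \<in> A" if "A \<in> T P ?x" for A using that by (auto simp: T_def)
  moreover have "?y \<in> A" if "A \<in> T Q ?y" for A using that by (auto simp: T_def)
  moreover have "?y \<notin> A" if "A \<in> T P ?x" for A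
    using that step.hyps by (auto simp: T_def P_def)
  ultimately have "?S n \<inter> T P ?x = {}" "(?S n \<union> T P ?x) \<inter> T Q ?y = {}"
    using new by blast+
  then have eq: "card (?S n \<union> T P ?x \<union> T Q ?y) = card (?S n) + (2 * n - 4) + (2 * n - 4)"
    using fin card_TP card_TQ by (simp add: card_Un_disjoint finite_star)
  have "1 + 2 * (n + 1 - 2) * (n + 1 - 3)
      = 1 + 2 * (n - 2) * (n - 3) + (2 * n - 4) + (2 * n - 4)"
  proof -
    obtain m where "n = m + 3" using step.hyps by (metis le_Suc_ex add.commute)
    then show ?thesis by (simp add: algebra_simps)
  qed
  with le eq step.IH show ?case by simp
qed

section \<open>Ladders with at most five rungs\<close>

text \<open>
  The lists partition the independent triples, and their bounds \<open>length As div 2\<close> add up to the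
  size of the star at a corner, so every list is tight for all four corner stars. For five rungs a
  partition into twelve triangles and one disjoint pair exists. For four rungs disjoint pairs
  alone bound the 12 triples by 6 only, and 8 vertices leave no room for three disjoint triples;
  the 5-cycles are what lowers the bound to 5.
\<close>

definition kneser_cycles :: "nat \<Rightarrow> ladder_vertex set list list" where
  "kneser_cycles n =
    (if n = 3 then
    [[{X 1, Y 2, X 3}, {Y 1, X 2, Y 3}]]
    else if n = 4 then
    [[{X 1, Y 2, X 3}, {Y 1, X 2, X 4}, {Y 2, X 3, Y 4}, {X 1, Y 3, X 4}, {Y 1, X 2, Y 4}],
     [{Y 1, X 2, Y 3}, {X 1, Y 2, X 4}, {Y 1, X 3, Y 4}, {X 2, Y 3, X 4}, {X 1, Y 2, Y 4}],
     [{X 1, X 3, Y 4}, {Y 1, Y 3, X 4}]]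
    else if n = 5 then
    [[{X 1, Y 2, X 5}, {Y 1, X 2, Y 5}],
     [{Y 1, X 2, Y 3}, {X 1, X 3, X 5}, {Y 2, X 4, Y 5}],
     [{Y 1, X 2, Y 4}, {X 1, Y 3, Y 5}, {Y 2, X 3, X 5}],
     [{Y 1, X 2, X 5}, {X 1, X 3, Y 4}, {Y 3, X 4, Y 5}],
     [{Y 1, X 3, Y 4}, {X 1, X 4, Y 5}, {X 2, Y 3, X 5}],
     [{X 1, Y 3, X 5}, {Y 1, X 4, Y 5}, {Y 2, X 3, Y 4}],
     [{X 1, Y 2, X 3}, {Y 1, Y 3, X 5}, {X 2, X 4, Y 5}],
     [{X 1, Y 2, Y 4}, {Y 1, X 3, X 5}, {X 2, Y 3, Y 5}],
     [{X 1, Y 2, X 4}, {Y 1, Y 3, Y 5}, {X 2, Y 4, X 5}],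
     [{Y 1, X 2, X 4}, {X 1, Y 2, Y 5}, {X 3, Y 4, X 5}],
     [{X 1, Y 3, X 4}, {Y 1, X 3, Y 5}, {Y 2, Y 4, X 5}],
     [{Y 1, Y 3, X 4}, {X 1, Y 4, X 5}, {Y 2, X 3, Y 5}],
     [{X 1, X 3, Y 5}, {Y 1, Y 4, X 5}, {X 2, Y 3, X 4}]]
    else [])"

lemma disjoint_kneser_cycles: "list_all disjoint_cycle (kneser_cycles n)"
  by (simp add: kneser_cycles_def disjoint_cycle_def)

lemma increasing_triple_cases:
  assumes "1 \<le> i" "i < j" "j < k" "k \<le> (5 :: nat)"
  shows "(i, j, k) \<in> {(1,2,3), (1,2,4), (1,2,5), (1,3,4), (1,3,5), (1,4,5),
    (2,3,4), (2,3,5), (2,4,5), (3,4,5)}"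
proof -
  have "i = 1 \<or> i = 2 \<or> i = 3" "j = 2 \<or> j = 3 \<or> j = 4" "k = 3 \<or> k = 4 \<or> k = 5"
    using assms by linarith+
  then show ?thesis using assms by (elim disjE) simp_all
qed

lemma column_eq_iff: "column v = i \<longleftrightarrow> v = X i \<or> v = Y i"
  by (cases v) auto

lemma indep_sets_subset_kneser_cycles:
  assumes "n \<le> 5"
  shows "indep_sets (ladder n) 3 \<subseteq> (\<Union>As\<in>set (kneser_cycles n). set As)"
proof
  fix A assume "A \<in> indep_sets (ladder n) 3"
  then obtain u v w where A: "A = {u, v, w}"
    and cols: "1 \<le> column u" "column u < column v" "column v < column w" "column w \<le> n"
    and arcs: "(u, v) \<notin> parcs (ladder n)" "(v, w) \<notin> parcs (ladder n)"
    by (rule indep_triple_sorted)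
  obtain i j k where ijk: "column u = i" "column v = j" "column w = k" by blast
  then have "u = X i \<or> u = Y i" "v = X j \<or> v = Y j" "w = X k \<or> w = Y k"
    by (simp_all add: column_eq_iff)
  moreover have "(i, j, k) \<in> {(1,2,3), (1,2,4), (1,2,5), (1,3,4), (1,3,5), (1,4,5),
      (2,3,4), (2,3,5), (2,4,5), (3,4,5)}"
    using cols assms ijk by (intro increasing_triple_cases) auto
  moreover have "n = 3 \<or> n = 4 \<or> n = 5" "k \<le> n" using cols ijk assms by linarith+
  \<comment> \<open>The entries of every table row are written by increasing column, so that after the
    substitution \<open>A\<close> occurs in the table literally, without reordering of set displays.\<close>
  ultimately show "A \<in> (\<Union>As\<in>set (kneser_cycles n). set As)"
    using arcs unfolding A insert_iff empty_iff Pair_inject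
    by (elim disjE conjE FalseE; hypsubst) (simp_all add: kneser_cycles_def)
qed

text \<open>
  The cases \<open>n \<le> 2\<close>, which have no independent triples, are separate because there truncated
  subtraction makes the formula for \<open>n \<ge> 3\<close> equal to 1.
\<close>

lemma intersecting_card_le_small:
  assumes "n \<le> 5" "F \<subseteq> indep_sets (ladder n) 3" "intersecting F"
  shows "card F \<le> (if n \<le> 2 then 0 else 1 + 2 * (n - 2) * (n - 3))"
proof -
  have "card F \<le> (\<Sum>As\<leftarrow>kneser_cycles n. length As div 2)"
    using indep_sets_subset_kneser_cycles[OF assms(1)] assms(2,3) disjoint_kneser_cycles
    by (intro intersecting_card_le_cycle_cover) auto
  also have "\<dots> = (if n \<le> 2 then 0 else 1 + 2 * (n - 2) * (n - 3))"
  proof -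
    consider "n \<le> 2" | "n = 3" | "n = 4" | "n = 5" using assms(1) by linarith
    then show ?thesis by cases (simp_all add: kneser_cycles_def)
  qed
  finally show ?thesis .
qed

section \<open>Comparison with the largest star\<close>

lemma EKR_I:
  assumes "finite (pverts G)"
    and le: "\<And>F. F \<subseteq> indep_sets G r \<Longrightarrow> intersecting F \<Longrightarrow>
      \<exists>v\<in>pverts G. card F \<le> card (star G r v)"
  shows "EKR r G"
proof -
  have "finite {card (star G r v) | v. v \<in> pverts G}"
    using assms(1) by (simp add: Setcompr_eq_image)
  then have "card (star G r v) \<le> Max {card (star G r v) | v. v \<in> pverts G}"
    if "v \<in> pverts G" for v
    using that by (intro Max_ge) auto
  then show ?thesis
    unfolding EKR_def by (meson le le_trans not_le)
qed

lemma intersecting_card_le_large: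
  assumes n: "n \<ge> 6" and F: "F \<subseteq> indep_sets (ladder n) 3" "intersecting F"
    and no_common: "\<And>v. \<exists>A\<in>F. v \<notin> A"
  shows "card F \<le> 1 + 2 * (n - 2) * (n - 3)"
proof -
  interpret nontrivial_triple_system F "2 * n - 5"
  proof
    show "finite F" using F(1) finite_indep_sets_ladder by (rule finite_subset)
    show "card {A \<in> F. u \<in> A \<and> w \<in> A} \<le> 2 * n - 5" if "u \<noteq> w" for u w
    proof -
      have "card {A \<in> F. u \<in> A \<and> w \<in> A}
          \<le> card {A \<in> indep_sets (ladder n) 3. u \<in> A \<and> w \<in> A}"
        using F(1) finite_indep_sets_ladder by (intro card_mono) auto
      also have "\<dots> \<le> 2 * n - 5"
        using n that by (intro card_indep_containing_pair_le) auto
      finally show ?thesis .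
    qed
  qed (use F no_common in \<open>auto simp: indep_sets_def\<close>)
  obtain m where m: "n = m + 6" using n by (metis le_Suc_ex add.commute)
  have "card F \<le> max 25 (3 * (2 * n - 5) + 3)" by (rule card_le)
  also have "\<dots> \<le> 1 + 2 * (n - 2) * (n - 3)"
    by (simp add: m algebra_simps)
  finally show ?thesis .
qed

theorem theorem1p29:
  fixes n :: nat
  assumes "n \<ge> 1"
  shows "EKR 3 (ladder n)"
proof (rule EKR_I[OF finite_pverts_ladder])
  fix F assume F: "F \<subseteq> indep_sets (ladder n) 3" "intersecting F"
  have corner: "X 1 \<in> pverts (ladder n)"
    using assms by (simp add: pverts_ladder)
  show "\<exists>v\<in>pverts (ladder n). card F \<le> card (star (ladder n) 3 v)"
  proof (cases "F \<noteq> {} \<and> (\<exists>v. \<forall>A\<in>F. v \<in> A)")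
    case True
    then obtain v where v: "\<forall>A\<in>F. v \<in> A" by blast
    then have "F \<subseteq> star (ladder n) 3 v" using F(1) by (auto simp: star_def)
    then have "card F \<le> card (star (ladder n) 3 v)" by (intro card_mono finite_star)
    moreover have "v \<in> pverts (ladder n)"
      using True v F(1) by (fastforce simp: indep_sets_def)
    ultimately show ?thesis by blast
  next
    case False
    \<comment> \<open>This includes the empty family, to whose members every element is vacuously common.\<close>
    have "card F \<le> (if n \<le> 2 then 0 else 1 + 2 * (n - 2) * (n - 3))"
    proof (cases "F = {} \<or> n \<le> 5")
      case True
      then show ?thesis using intersecting_card_le_small[OF _ F] by auto
    next
      case False': False
      then show ?thesis
        using intersecting_card_le_large[OF _ F] False by (auto split: if_splits)
    qed
    also have "\<dots> \<le> card (star (ladder n) 3 (X 1))"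
      using card_star_corner_ge[of n] by simp
    finally show ?thesis using corner by blast
  qed
qed

end
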